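(* Let $G$ be a lobster which is not a path or a caterpillar, let $\Delta$ be the maximum degree of $G$, and let $\Delta_1$ and $\Delta_2$ be the maximum degrees of the primary and of the secondary vertices of $G$, respectively. Then $\Delta+1\leq \chi_{td}(G)\leq \Delta_1+\Delta_2+1$.
   Context: Graphs are finite, simple and undirected. A caterpillar is a tree in which all vertices are at distance at most 1 from a central path. A lobster is a tree in which all vertices are at distance at most 2 from a central path. In a lobster with its central path, the vertices on the central path are the primary vertices; the vertices adjacent to primary vertices that are not themselves primary are the secondary vertices; the leaves adjacent to secondary vertices (not primary) are the tertiary vertices. $\Delta_1$ is the maximum degree (in $G$) of the primary vertices and $\Delta_2$ is the maximum degree (in $G$) of the secondary vertices. A total labeling of a graph $G$ is a function $f:V(G)\cup E(G)\to\mathbb{Z}^+$ (positive integers) such that $f(u)\neq f(v)$ for adjacent vertices $u,v$; $f(\{u,v\})\neq f(\{v,w\})$ for any two distinct incident edges $\{u,v\},\{v,w\}$; and $f(u)\neq f(\{u,v\})$ for every edge $\{u,v\}$ and incident vertex $u$. It is a $k$-total labeling if the maximum label assigned to any vertex or edge is $k$. A $k$-total difference labeling is a $k$-total labeling $f$ with $f(\{u,v\})=|f(u)-f(v)|$ for every edge $\{u,v\}$. The total difference chromatic number $\chi_{td}(G)$ is the smallest integer $k$ for which $G$ has a $k$-total difference labeling. *)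

theory Defs
  imports Main
begin

text \<open>A graph is given by its vertex set and its set of edges, an edge being a two-element set of
  vertices.  (The trees of the AFP entry Graph Theory are directed: there, a symmetric pair of arcs
  already forms a cycle, so that notion does not fit undirected graphs.)\<close>

definition simple_graph :: "'a set \<Rightarrow> 'a set set \<Rightarrow> bool" where
  "simple_graph V E \<longleftrightarrow> finite V \<and> (\<forall>e\<in>E. e \<subseteq> V \<and> card e = 2)"

definition degree :: "'a set set \<Rightarrow> 'a \<Rightarrow> nat" where
  "degree E v = card {e \<in> E. v \<in> e}"

text \<open>Maximum degree in the whole graph of the vertices in \<open>S\<close>.\<close>

definition max_degree :: "'a set set \<Rightarrow> 'a set \<Rightarrow> nat" where
  "max_degree E S = Max (degree E ` S)"

definition walk :: "'a set \<Rightarrow> 'a set set \<Rightarrow> 'a list \<Rightarrow> bool" where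
  "walk V E p \<longleftrightarrow> p \<noteq> [] \<and> set p \<subseteq> V \<and> successively (\<lambda>u v. {u, v} \<in> E) p"

text \<open>A single vertex counts as a path (of length 0).\<close>

definition path_in :: "'a set \<Rightarrow> 'a set set \<Rightarrow> 'a list \<Rightarrow> bool" where
  "path_in V E p \<longleftrightarrow> walk V E p \<and> distinct p"

definition cycle_in :: "'a set \<Rightarrow> 'a set set \<Rightarrow> 'a list \<Rightarrow> bool" where
  "cycle_in V E p \<longleftrightarrow> path_in V E p \<and> 3 \<le> length p \<and> {last p, hd p} \<in> E"

definition connected_graph :: "'a set \<Rightarrow> 'a set set \<Rightarrow> bool" where
  "connected_graph V E \<longleftrightarrow>
     V \<noteq> {} \<and> (\<forall>u\<in>V. \<forall>v\<in>V. \<exists>p. walk V E p \<and> hd p = u \<and> last p = v)"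

definition tree :: "'a set \<Rightarrow> 'a set set \<Rightarrow> bool" where
  "tree V E \<longleftrightarrow> simple_graph V E \<and> connected_graph V E \<and> (\<nexists>p. cycle_in V E p)"

text \<open>Only used in connected graphs, where the minimum is attained.\<close>

definition graph_dist :: "'a set \<Rightarrow> 'a set set \<Rightarrow> 'a \<Rightarrow> 'a \<Rightarrow> nat" where
  "graph_dist V E u v =
     (LEAST n. \<exists>p. walk V E p \<and> hd p = u \<and> last p = v \<and> length p = Suc n)"

definition path_graph :: "'a set \<Rightarrow> 'a set set \<Rightarrow> bool" where
  "path_graph V E \<longleftrightarrow>
     (\<exists>p. p \<noteq> [] \<and> distinct p \<and> V = set p \<and> E = {{p ! i, p ! Suc i} | i. Suc i < length p})"

definition central_path :: "'a set \<Rightarrow> 'a set set \<Rightarrow> nat \<Rightarrow> 'a list \<Rightarrow> bool" where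
  "central_path V E r P \<longleftrightarrow>
     path_in V E P \<and> (\<forall>v\<in>V. \<exists>w\<in>set P. graph_dist V E v w \<le> r)"

definition caterpillar :: "'a set \<Rightarrow> 'a set set \<Rightarrow> bool" where
  "caterpillar V E \<longleftrightarrow> tree V E \<and> (\<exists>P. central_path V E 1 P)"

text \<open>A lobster together with a choice \<open>P\<close> of its central path; the primary and secondary
  vertices depend on this choice.\<close>

definition lobster :: "'a set \<Rightarrow> 'a set set \<Rightarrow> 'a list \<Rightarrow> bool" where
  "lobster V E P \<longleftrightarrow> tree V E \<and> central_path V E 2 P"

definition primary :: "'a list \<Rightarrow> 'a set" where
  "primary P = set P"

definition secondary :: "'a set \<Rightarrow> 'a set set \<Rightarrow> 'a list \<Rightarrow> 'a set" where
  "secondary V E P = {v \<in> V. v \<notin> primary P \<and> (\<exists>u\<in>primary P. {u, v} \<in> E)}"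

text \<open>A total labeling is a function on the disjoint union of \<open>V\<close> (left summands) and \<open>E\<close>
  (right summands).\<close>

definition total_labeling :: "'a set \<Rightarrow> 'a set set \<Rightarrow> ('a + 'a set \<Rightarrow> nat) \<Rightarrow> bool" where
  "total_labeling V E f \<longleftrightarrow>
     (\<forall>x \<in> V <+> E. 0 < f x) \<and>
     (\<forall>u v. {u, v} \<in> E \<longrightarrow> f (Inl u) \<noteq> f (Inl v)) \<and>
     (\<forall>e\<in>E. \<forall>e'\<in>E. e \<noteq> e' \<and> e \<inter> e' \<noteq> {} \<longrightarrow> f (Inr e) \<noteq> f (Inr e')) \<and>
     (\<forall>e\<in>E. \<forall>u\<in>e. f (Inl u) \<noteq> f (Inr e))"

definition k_total_labeling ::
    "'a set \<Rightarrow> 'a set set \<Rightarrow> nat \<Rightarrow> ('a + 'a set \<Rightarrow> nat) \<Rightarrow> bool" where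
  "k_total_labeling V E k f \<longleftrightarrow> total_labeling V E f \<and> Max (f ` (V <+> E)) = k"

definition k_total_difference_labeling ::
    "'a set \<Rightarrow> 'a set set \<Rightarrow> nat \<Rightarrow> ('a + 'a set \<Rightarrow> nat) \<Rightarrow> bool" where
  "k_total_difference_labeling V E k f \<longleftrightarrow>
     k_total_labeling V E k f \<and>
     (\<forall>u v. {u, v} \<in> E \<longrightarrow> int (f (Inr {u, v})) = \<bar>int (f (Inl u)) - int (f (Inl v))\<bar>)"

text \<open>The minimum exists for every nonempty finite simple graph: label the vertices by distinct
  powers of 3.\<close>

definition chi_td :: "'a set \<Rightarrow> 'a set set \<Rightarrow> nat" where
  "chi_td V E = (LEAST k. \<exists>f. k_total_difference_labeling V E k f)"

end

theory Submission
  imports Defs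
begin

text \<open>Put \<open>K = \<Delta>\<^sub>1 + \<Delta>\<^sub>2 + 1\<close> and label the central path cyclically by \<open>1, K, K - 1\<close>.  A difference
  labeling is determined by its vertex labels, and the neighbours of a vertex labelled \<open>b\<close> need labels
  at pairwise distinct distances from \<open>b\<close>, none of them equal to \<open>2b\<close> or \<open>b/2\<close>.  The secondary vertices
  can be given labels that are at most \<open>\<Delta>\<^sub>1\<close> or at least \<open>\<Delta>\<^sub>2 + 2\<close>; such a label \<open>x\<close> leaves at least
  \<open>\<Delta>\<^sub>2\<close> distances for its neighbours, by taking labels above \<open>x\<close> in the first case and below \<open>x\<close> in the
  second.  For the lower bound, a vertex and its incident edges carry distinct labels.\<close>

section \<open>Vertex labels, neighbourhoods and degrees\<close>

definition neighbours :: "'a set set \<Rightarrow> 'a \<Rightarrow> 'a set" where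
  "neighbours E v = {u. {u, v} \<in> E}"

text \<open>For positive \<open>a\<close> and \<open>b\<close> the edge label |a - b| is 0 iff
  \<open>a = b\<close>, and equals an end label iff one of \<open>a\<close>, \<open>b\<close> is
  twice the other.\<close>

definition compatible :: "nat \<Rightarrow> nat \<Rightarrow> bool" where
  "compatible a b \<longleftrightarrow> a \<noteq> b \<and> a \<noteq> 2 * b \<and> b \<noteq> 2 * a"

definition label_dist :: "nat \<Rightarrow> nat \<Rightarrow> int" where
  "label_dist a b = \<bar>int a - int b\<bar>"

text \<open>Relative to a part \<open>W\<close> of the graph, because the labels are assigned in
  rounds: central path, secondary vertices, remaining vertices.\<close>

definition vertex_labeling :: "'a set \<Rightarrow> 'a set set \<Rightarrow> ('a \<Rightarrow> nat) \<Rightarrow> bool" where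
  "vertex_labeling W E g \<longleftrightarrow>
     (\<forall>u\<in>W. \<forall>v\<in>W. {u, v} \<in> E \<longrightarrow> compatible (g u) (g v)) \<and>
     (\<forall>v\<in>W. inj_on (\<lambda>u. label_dist (g v) (g u)) (W \<inter> neighbours E v))"

lemma compatible_sym: "compatible a b \<Longrightarrow> compatible b a"
  by (auto simp: compatible_def)

lemma simple_graph_edge:
  assumes "simple_graph V E" "{u, v} \<in> E"
  shows "u \<in> V" "v \<in> V" "u \<noteq> v"
  using assms unfolding simple_graph_def by (fastforce simp: card_insert_if)+

lemma simple_graph_edgeE:
  assumes "simple_graph V E" "e \<in> E" "v \<in> e"
  obtains u where "e = {u, v}" "u \<noteq> v"
proof -
  have "card e = 2" using assms by (auto simp: simple_graph_def)
  then obtain a b where "e = {a, b}" "a \<noteq> b" by (auto simp: card_2_iff)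
  with assms(3) that show thesis by (metis doubleton_eq_iff insertE singletonD)
qed

lemma simple_graph_finite_edges: "simple_graph V E \<Longrightarrow> finite E"
  unfolding simple_graph_def by (meson PowI finite_Pow_iff finite_subset subsetI)

lemma neighbours_subset: "simple_graph V E \<Longrightarrow> neighbours E v \<subseteq> V"
  using simple_graph_edge(1) by (fastforce simp: neighbours_def)

lemma finite_neighbours: "simple_graph V E \<Longrightarrow> finite (neighbours E v)"
  by (meson finite_subset neighbours_subset simple_graph_def)

lemma neighbours_sym: "u \<in> neighbours E v \<longleftrightarrow> v \<in> neighbours E u"
  by (simp add: neighbours_def insert_commute)

lemma degree_eq_card_neighbours:
  assumes "simple_graph V E"
  shows "degree E v = card (neighbours E v)"
proof -
  have "{e \<in> E. v \<in> e} = (\<lambda>u. {u, v}) ` neighbours E v"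
    using assms by (auto simp: neighbours_def elim!: simple_graph_edgeE)
  moreover have "inj_on (\<lambda>u. {u, v}) (neighbours E v)"
    by (auto simp: inj_on_def doubleton_eq_iff)
  ultimately show ?thesis by (simp add: degree_def card_image)
qed

lemma degree_le_max_degree: "finite S \<Longrightarrow> v \<in> S \<Longrightarrow> degree E v \<le> max_degree E S"
  by (simp add: max_degree_def)

section \<open>From vertex labelings to total difference labelings, and the lower bound on the
  number of labels\<close>

text \<open>Compatibility keeps edge labels positive and apart from the end labels; injectivity of
  distances separates edges at a common vertex. Since \<open>k\<close> is the largest label actually
  used, only \<open>k \<le> K\<close> can be claimed.\<close>

lemma total_difference_labeling_of_vertex_labeling:
  assumes G: "simple_graph V E" and "V \<noteq> {}"
    and lab: "vertex_labeling V E g" and range: "\<And>v. v \<in> V \<Longrightarrow> g v \<in> {1..K}"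
  obtains k f where "k_total_difference_labeling V E k f" "k \<le> K"
proof -
  \<comment> \<open>On an edge, \<open>Max\<close> minus \<open>Min\<close> is the absolute
    difference, expressed without choosing an order of the two ends.\<close>
  define f where "f = case_sum g (\<lambda>e. Max (g ` e) - Min (g ` e))"
  have vertex: "f (Inl v) = g v" for v by (simp add: f_def)
  have edge: "int (f (Inr {u, v})) = label_dist (g u) (g v)" for u v
    by (simp add: f_def label_dist_def max_def min_def)
  have compat: "compatible (g u) (g v)" if "{u, v} \<in> E" for u v
    using lab that simple_graph_edge[OF G that] by (auto simp: vertex_labeling_def)
  have bounds: "f x \<in> {1..K}" if "x \<in> V <+> E" for x
    using that
  proof
    fix e assume x: "x = Inr e" and e: "e \<in> E"
    then have "card e = 2" using G by (auto simp: simple_graph_def)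
    then obtain u v where uv: "e = {u, v}" by (auto simp: card_2_iff)
    show ?thesis
      using edge[of u v] compat[of u v] range[of u] range[of v] simple_graph_edge[OF G, of u v] e uv x
      by (auto simp: label_dist_def compatible_def)
  qed (use vertex range in simp)
  have distinct_edges: "f (Inr e) \<noteq> f (Inr e')"
    if e: "e \<in> E" "e' \<in> E" "e \<noteq> e'" "v \<in> e" "v \<in> e'" for e e' v
  proof -
    obtain u where u: "e = {u, v}" using simple_graph_edgeE[OF G e(1) e(4)] .
    obtain w where w: "e' = {w, v}" using simple_graph_edgeE[OF G e(2) e(5)] .
    have "u \<noteq> w" "u \<in> V \<inter> neighbours E v" "w \<in> V \<inter> neighbours E v" "v \<in> V"
      using u w e simple_graph_edge[OF G] by (auto simp: neighbours_def)
    then have "label_dist (g v) (g u) \<noteq> label_dist (g v) (g w)"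
      using lab unfolding vertex_labeling_def inj_on_def by blast
    then show ?thesis
      using edge[of u v] edge[of w v] u w by (auto simp: label_dist_def)
  qed
  have vertex_edge: "f (Inl v) \<noteq> f (Inr e)" if e: "e \<in> E" "v \<in> e" for e v
  proof -
    obtain u where u: "e = {u, v}" using simple_graph_edgeE[OF G e] .
    show ?thesis
      using edge[of u v] compat[of u v] u e range[of u] simple_graph_edge(1)[OF G, of u v]
      by (auto simp: vertex label_dist_def compatible_def)
  qed
  let ?k = "Max (f ` (V <+> E))"
  have "total_labeling V E f"
    unfolding total_labeling_def
  proof (intro conjI)
    show "\<forall>x\<in>V <+> E. 0 < f x" using bounds by force
    show "\<forall>u v. {u, v} \<in> E \<longrightarrow> f (Inl u) \<noteq> f (Inl v)"
      using compat by (auto simp: vertex compatible_def)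
  qed (use distinct_edges vertex_edge in blast)+
  then have "k_total_difference_labeling V E ?k f"
    by (simp add: k_total_difference_labeling_def k_total_labeling_def vertex
        edge[unfolded label_dist_def])
  moreover have "?k \<le> K"
  proof (rule Max.boundedI)
    show "finite (f ` (V <+> E))"
      using G simple_graph_finite_edges[OF G] by (auto simp: simple_graph_def)
  qed (use \<open>V \<noteq> {}\<close> bounds in auto)
  ultimately show thesis by (rule that)
qed

text \<open>Pigeonhole: the \<open>degree E v + 1\<close> labels at \<open>v\<close> and on its
  edges are distinct elements of \<open>{1..k}\<close>.\<close>

lemma degree_less_label_bound:
  assumes G: "simple_graph V E" and v: "v \<in> V" and lab: "k_total_labeling V E k f"
  shows "degree E v + 1 \<le> k"
proof -
  let ?I = "{e \<in> E. v \<in> e}"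
  let ?L = "insert (f (Inl v)) ((\<lambda>e. f (Inr e)) ` ?I)"
  have t: "total_labeling V E f" and k: "Max (f ` (V <+> E)) = k"
    using lab by (auto simp: k_total_labeling_def)
  have fin: "finite (V <+> E)" "finite ?I"
    using G simple_graph_finite_edges[OF G] by (auto simp: simple_graph_def)
  have "inj_on (\<lambda>e. f (Inr e)) ?I"
    using t unfolding total_labeling_def inj_on_def by blast
  then have "card ((\<lambda>e. f (Inr e)) ` ?I) = degree E v"
    by (simp add: card_image degree_def)
  moreover have "f (Inl v) \<notin> (\<lambda>e. f (Inr e)) ` ?I"
    using t unfolding total_labeling_def by blast
  ultimately have "card ?L = degree E v + 1" using fin by simp
  moreover have "?L \<subseteq> {1..k}"
  proof -
    have "?L \<subseteq> f ` (V <+> E)" using v by auto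
    moreover have "f ` (V <+> E) \<subseteq> {1..k}"
      using t fin k by (force simp: total_labeling_def Suc_le_eq)
    ultimately show ?thesis by (rule subset_trans)
  qed
  ultimately show ?thesis by (metis card_atLeastAtMost card_mono diff_Suc_1 finite_atLeastAtMost)
qed

section \<open>Extending a labeling to new vertices\<close>

text \<open>\<open>S\<close> is to hold the new neighbours of a vertex, \<open>F\<close> the
  distances already taken there, and \<open>N\<close> the admissible labels. As \<open>d\<close> is
  injective on \<open>N\<close>, at least \<open>card S\<close> values of \<open>d\<close> remain
  outside \<open>F\<close>; distinct ones are picked and pulled back to labels.\<close>

lemma choose_labels:
  assumes "finite S" "finite F" "finite N" "inj_on d N" "card S + card F \<le> card N"
  obtains h where "h ` S \<subseteq> N" "inj_on (\<lambda>s. d (h s)) S" "(\<lambda>s. d (h s)) ` S \<inter> F = {}"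
proof -
  have "card S \<le> card (d ` N - F)"
    using assms diff_card_le_card_Diff[of F "d ` N"] by (simp add: card_image)
  then obtain r where r: "r ` S \<subseteq> d ` N - F" "inj_on r S"
    using assms(1,3) by (metis card_le_inj finite_Diff finite_imageI)
  let ?h = "\<lambda>s. the_inv_into N d (r s)"
  have d: "d (?h s) = r s" if "s \<in> S" for s
    using r(1) that by (intro f_the_inv_into_f[OF assms(4)]) auto
  show thesis
  proof (rule that)
    show "?h ` S \<subseteq> N" using r(1) assms(4) the_inv_into_into[of d N _ N] by blast
    show "inj_on (\<lambda>s. d (?h s)) S" using r(2) d by (simp cong: inj_on_cong)
    show "(\<lambda>s. d (?h s)) ` S \<inter> F = {}" using r(1) d by auto
  qed
qed

text \<open>Each new vertex has exactly one neighbour in \<open>W \<union> C\<close>, its parent in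
  \<open>W\<close>, so the choices at different parents do not interact. At a parent
  \<open>w\<close>, distances already used plus new neighbours number at most
  \<open>degree E w\<close>, hence at most \<open>card (N w)\<close>.\<close>

lemma extend_vertex_labeling:
  assumes G: "simple_graph V E" and lab: "vertex_labeling W E g"
    and disj: "W \<inter> C = {}"
    and unique: "\<And>c. c \<in> C \<Longrightarrow> \<exists>w. W \<inter> neighbours E c = {w}"
    and indep: "\<And>c c'. c \<in> C \<Longrightarrow> c' \<in> C \<Longrightarrow> {c, c'} \<notin> E"
    and N: "\<And>w. w \<in> W \<Longrightarrow> C \<inter> neighbours E w \<noteq> {} \<Longrightarrow>
      finite (N w) \<and> inj_on (label_dist (g w)) (N w) \<and>
      (\<forall>y\<in>N w. compatible (g w) y) \<and> degree E w \<le> card (N w)"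
  obtains g' where "vertex_labeling (W \<union> C) E g'" "\<And>w. w \<in> W \<Longrightarrow> g' w = g w"
    "\<And>c. c \<in> C \<Longrightarrow> \<exists>w \<in> W \<inter> neighbours E c. g' c \<in> N w"
proof -
  define d where "d = (\<lambda>w u. label_dist (g w) (g u))"
  have "\<exists>h. h ` (C \<inter> neighbours E w) \<subseteq> N w \<and>
      inj_on (\<lambda>s. label_dist (g w) (h s)) (C \<inter> neighbours E w) \<and>
      (\<lambda>s. label_dist (g w) (h s)) ` (C \<inter> neighbours E w) \<inter> d w ` (W \<inter> neighbours E w) = {}"
    if w: "w \<in> W" "C \<inter> neighbours E w \<noteq> {}" for w
  proof -
    have fin: "finite (neighbours E w)" using G by (rule finite_neighbours)
    have "card (C \<inter> neighbours E w) + card (W \<inter> neighbours E w)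
        = card ((C \<inter> neighbours E w) \<union> (W \<inter> neighbours E w))"
      using fin disj by (intro card_Un_disjoint[symmetric]) auto
    also have "\<dots> \<le> degree E w"
      unfolding degree_eq_card_neighbours[OF G] using fin by (intro card_mono) auto
    finally have "card (C \<inter> neighbours E w) + card (d w ` (W \<inter> neighbours E w)) \<le> card (N w)"
      using N[OF w] card_image_le[of "W \<inter> neighbours E w" "d w"] fin by simp
    then show ?thesis
      using choose_labels[of "C \<inter> neighbours E w" "d w ` (W \<inter> neighbours E w)" "N w"
          "label_dist (g w)"] fin N[OF w] by (metis finite_Int finite_imageI)
  qed
  then obtain h where h:
    "\<And>w. w \<in> W \<Longrightarrow> C \<inter> neighbours E w \<noteq> {} \<Longrightarrow> h w ` (C \<inter> neighbours E w) \<subseteq> N w"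
    "\<And>w. w \<in> W \<Longrightarrow> C \<inter> neighbours E w \<noteq> {} \<Longrightarrow>
       inj_on (\<lambda>s. label_dist (g w) (h w s)) (C \<inter> neighbours E w)"
    "\<And>w. w \<in> W \<Longrightarrow> C \<inter> neighbours E w \<noteq> {} \<Longrightarrow>
       (\<lambda>s. label_dist (g w) (h w s)) ` (C \<inter> neighbours E w) \<inter> d w ` (W \<inter> neighbours E w) = {}"
    by metis
  from unique obtain par where par: "\<And>c. c \<in> C \<Longrightarrow> W \<inter> neighbours E c = {par c}"
    by metis
  define g' where "g' = (\<lambda>v. if v \<in> W then g v else h (par v) v)"
  have old: "g' w = g w" if "w \<in> W" for w using that by (simp add: g'_def)
  \<comment> \<open>The parent is unique, so \<open>w\<close> is the only old vertex whose choice
    function is applied to \<open>c\<close>.\<close>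
  have new: "g' c = h w c" if "w \<in> W" "c \<in> C \<inter> neighbours E w" for w c
  proof -
    have "w = par c" using par[of c] that neighbours_sym[of w E c] by blast
    then show ?thesis using that disj by (auto simp: g'_def)
  qed
  have new_N: "g' c \<in> N w" if "w \<in> W" "c \<in> C \<inter> neighbours E w" for w c
    using h(1)[of w] new[OF that] that by auto
  show thesis
  proof (rule that[of g'])
    show "\<And>w. w \<in> W \<Longrightarrow> g' w = g w" by (rule old)
    show "\<exists>w\<in>W \<inter> neighbours E c. g' c \<in> N w" if "c \<in> C" for c
      using par[OF that] new_N[of "par c" c] that neighbours_sym[of c E] by blast
    have cross: "compatible (g' u) (g' c)" if "u \<in> W" "c \<in> C" "{u, c} \<in> E" for u c
    proof -
      have c: "c \<in> C \<inter> neighbours E u"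
        using that by (simp add: neighbours_def insert_commute)
      then show ?thesis using N[of u] new_N[OF that(1) c] old that(1) by auto
    qed
    show "vertex_labeling (W \<union> C) E g'"
      unfolding vertex_labeling_def
    proof (intro conjI ballI impI)
      fix u v assume uv: "u \<in> W \<union> C" "v \<in> W \<union> C" "{u, v} \<in> E"
      then consider "u \<in> W" "v \<in> W" | "u \<in> W" "v \<in> C" | "u \<in> C" "v \<in> W"
        using indep by blast
      then show "compatible (g' u) (g' v)"
      proof cases
        case 1
        then show ?thesis using lab uv old by (auto simp: vertex_labeling_def)
      next
        case 2
        then show ?thesis using cross uv by blast
      next
        case 3
        then show ?thesis using cross[of v u] uv by (simp add: compatible_sym insert_commute)
      qed
    next
      fix v assume "v \<in> W \<union> C"
      then show "inj_on (\<lambda>u. label_dist (g' v) (g' u)) ((W \<union> C) \<inter> neighbours E v)"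
      proof
        assume v: "v \<in> C"
        then have "(W \<union> C) \<inter> neighbours E v = {par v}"
          using par[OF v] indep by (auto simp: neighbours_def)
        then show ?thesis by simp
      next
        assume v: "v \<in> W"
        have "inj_on (\<lambda>u. label_dist (g' v) (g' u)) (W \<inter> neighbours E v)"
          using lab v old by (auto simp: vertex_labeling_def inj_on_def)
        moreover have "inj_on (\<lambda>u. label_dist (g' v) (g' u)) (C \<inter> neighbours E v)"
          using h(2)[OF v] old[OF v] new[OF v] unfolding inj_on_def by (metis empty_iff)
        \<comment> \<open>Here the choice avoiding the distances already taken at \<open>v\<close>
          is used.\<close>
        moreover have "label_dist (g' v) (g' u) \<noteq> label_dist (g' v) (g' c)"
          if "u \<in> W \<inter> neighbours E v" "c \<in> C \<inter> neighbours E v" for u c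
          using h(3)[OF v] old v new[OF v that(2)] that unfolding d_def by fastforce
        ultimately show ?thesis
          unfolding Int_Un_distrib2 inj_on_def by (metis Un_iff)
      qed
    qed
  qed
qed

section \<open>Paths and distances in trees\<close>

lemma tree_no_cycle: "tree V E \<Longrightarrow> \<not> cycle_in V E p"
  by (auto simp: tree_def)

lemma path_in_Cons:
  "path_in V E (x # y # p) \<longleftrightarrow>
     x \<in> V \<and> {x, y} \<in> E \<and> x \<notin> set (y # p) \<and> path_in V E (y # p)"
  by (auto simp: path_in_def walk_def)

lemma path_in_singleton: "path_in V E [x] \<longleftrightarrow> x \<in> V"
  by (simp add: path_in_def walk_def)

lemma path_in_rev: "path_in V E (rev p) \<longleftrightarrow> path_in V E p"
  by (simp add: path_in_def walk_def insert_commute)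

lemma path_in_append:
  assumes "path_in V E p" "path_in V E q" "set p \<inter> set q = {}" "{last p, hd q} \<in> E"
  shows "path_in V E (p @ q)"
  using assms by (auto simp: path_in_def walk_def successively_append_iff)

lemma path_in_segment:
  assumes P: "path_in V E P" and ij: "i \<le> j" "j < length P"
  obtains R where "path_in V E R" "set R \<subseteq> set P" "hd R = P ! i" "last R = P ! j"
    "length R = Suc (j - i)"
proof (rule that)
  let ?R = "drop i (take (Suc j) P)"
  have "P = (take i (take (Suc j) P) @ ?R) @ drop (Suc j) P"
    by (simp only: append_take_drop_id)
  then have "successively (\<lambda>u v. {u, v} \<in> E) ?R"
    using P unfolding path_in_def walk_def by (metis successively_append_iff)
  then show "path_in V E ?R"
    using P ij by (auto simp: path_in_def walk_def dest: in_set_dropD in_set_takeD)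
  show "set ?R \<subseteq> set P" by (auto dest: in_set_dropD in_set_takeD)
  show "hd ?R = P ! i" using ij by (simp add: hd_drop_conv_nth)
  show "last ?R = P ! j" using ij by (simp add: last_drop take_Suc_conv_app_nth)
  show "length ?R = Suc (j - i)" using ij by simp
qed

text \<open>Any other chord would close the segment between its ends, of at least three vertices,
  into a cycle.\<close>

lemma tree_path_adjacent:
  assumes T: "tree V E" and P: "path_in V E P" and ij: "i < j" "j < length P"
    and e: "{P ! i, P ! j} \<in> E"
  shows "j = Suc i"
proof (rule ccontr)
  assume "j \<noteq> Suc i"
  obtain R where "path_in V E R" "hd R = P ! i" "last R = P ! j" "length R = Suc (j - i)"
    using path_in_segment[OF P, of i j] ij by auto
  then have "cycle_in V E R"
    using e ij \<open>j \<noteq> Suc i\<close> by (simp add: cycle_in_def insert_commute)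
  with T show False by (simp add: tree_no_cycle)
qed

text \<open>The segment of \<open>P\<close> from \<open>p\<close> to \<open>p'\<close> followed by
  \<open>Q\<close> backwards closes to a cycle as soon as it has three vertices; it has fewer only
  in the case stated.\<close>

lemma tree_no_detour:
  assumes T: "tree V E" and P: "path_in V E P" and Q: "path_in V E Q"
    and disj: "set P \<inter> set Q = {}" and p: "p \<in> set P" "p' \<in> set P"
    and e: "{p, hd Q} \<in> E" "{p', last Q} \<in> E"
  shows "p = p' \<and> length Q = 1"
proof -
  \<comment> \<open>Stated for arbitrary \<open>Q\<close>, so that the case \<open>j < i\<close>
    follows by reversing \<open>Q\<close>.\<close>
  have *: "i = j \<and> length Q = 1"
    if Q: "path_in V E Q" "set P \<inter> set Q = {}" and ij: "i \<le> j" "j < length P"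
      and e: "{P ! i, hd Q} \<in> E" "{P ! j, last Q} \<in> E" for i j Q
  proof (rule ccontr)
    assume no: "\<not> (i = j \<and> length Q = 1)"
    obtain R where R: "path_in V E R" "set R \<subseteq> set P" "hd R = P ! i" "last R = P ! j"
      "length R = Suc (j - i)"
      using path_in_segment[OF P ij] .
    have ne: "R \<noteq> []" "Q \<noteq> []" using R(1) Q(1) by (auto simp: path_in_def walk_def)
    have "path_in V E (R @ rev Q)"
      using R Q e ne by (intro path_in_append) (auto simp: path_in_rev hd_rev)
    moreover have "3 \<le> length (R @ rev Q)"
    proof -
      have "0 < length Q" using ne by simp
      then show ?thesis using no R(5) ij(1) unfolding length_append length_rev by linarith
    qed
    moreover have "{last (R @ rev Q), hd (R @ rev Q)} \<in> E"
      using e ne R by (simp add: last_rev insert_commute)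
    ultimately have "cycle_in V E (R @ rev Q)" by (simp add: cycle_in_def)
    with T show False by (simp add: tree_no_cycle)
  qed
  obtain i j where ij: "i < length P" "p = P ! i" "j < length P" "p' = P ! j"
    using p by (auto simp: in_set_conv_nth)
  show ?thesis
  proof (cases "i \<le> j")
    case True
    then show ?thesis using *[OF Q disj True] ij e by auto
  next
    case False
    have "Q \<noteq> []" using Q by (auto simp: path_in_def walk_def)
    then show ?thesis
      using *[of "rev Q" j i] False ij e Q disj by (auto simp: path_in_rev hd_rev last_rev)
  qed
qed

text \<open>For two adjacent vertices with the same secondary neighbour: there the route between
  central-path vertices would repeat a vertex, and \<open>tree_no_detour\<close> does not
  apply.\<close>

lemma tree_no_triangle:
  assumes T: "tree V E" and e: "{a, b} \<in> E" "{b, c} \<in> E" "{c, a} \<in> E"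
  shows False
proof -
  have G: "simple_graph V E" using T by (simp add: tree_def)
  have "cycle_in V E [a, b, c]"
    using e simple_graph_edge[OF G e(1)] simple_graph_edge[OF G e(2)] simple_graph_edge[OF G e(3)]
    by (auto simp: cycle_in_def path_in_Cons path_in_singleton)
  with T show False by (simp add: tree_no_cycle)
qed

lemma graph_dist_walk:
  assumes "connected_graph V E" "u \<in> V" "v \<in> V"
  obtains p where "walk V E p" "hd p = u" "last p = v" "length p = Suc (graph_dist V E u v)"
proof -
  obtain p where "walk V E p" "hd p = u" "last p = v"
    using assms unfolding connected_graph_def by blast
  then have "\<exists>n p. walk V E p \<and> hd p = u \<and> last p = v \<and> length p = Suc n"
    by (metis Suc_pred length_greater_0_conv walk_def)
  from LeastI_ex[OF this] that show thesis unfolding graph_dist_def by blast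
qed

lemma graph_dist_le:
  assumes "walk V E p" "hd p = u" "last p = v" "length p = Suc n"
  shows "graph_dist V E u v \<le> n"
  unfolding graph_dist_def using assms by (blast intro: Least_le)

section \<open>The supply of labels around a given label\<close>

lemma label_dist_inj_ge:
  assumes "N \<subseteq> {b..}"
  shows "inj_on (label_dist b) N"
proof (rule inj_onI)
  fix x y assume "x \<in> N" "y \<in> N" and eq: "label_dist b x = label_dist b y"
  then have "b \<le> x \<and> b \<le> y" using assms by auto
  with eq show "x = y" by (simp add: label_dist_def)
qed

lemma label_dist_inj_le:
  assumes "N \<subseteq> {..b}"
  shows "inj_on (label_dist b) N"
proof (rule inj_onI)
  fix x y assume "x \<in> N" "y \<in> N" and eq: "label_dist b x = label_dist b y"
  then have "x \<le> b \<and> y \<le> b" using assms by auto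
  with eq show "x = y" by (simp add: label_dist_def)
qed

text \<open>\<open>D1\<close> and \<open>D2\<close> stand for the maximum primary and secondary
  degrees. The bound on \<open>D2\<close> will come from the graph not being a caterpillar; together
  the bounds give \<open>K \<ge> 4\<close>.\<close>

locale lobster_labels =
  fixes D1 D2 K :: nat
  assumes D1: "1 \<le> D1" and D2: "2 \<le> D2" and K: "K = D1 + D2 + 1"
begin

text \<open>\<open>spread b D N\<close>: the labels in \<open>N\<close> suffice for the neighbours of a vertex labelled \<open>b\<close> of
  degree at most \<open>D\<close>.\<close>

definition spread :: "nat \<Rightarrow> nat \<Rightarrow> nat set \<Rightarrow> bool" where
  "spread b D N \<longleftrightarrow> finite N \<and> inj_on (label_dist b) N \<and> (\<forall>y\<in>N. compatible b y) \<and> D \<le> card N"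

definition secondary_labels :: "nat set" where
  "secondary_labels = {x \<in> {1..K}. x \<le> D1 \<or> D2 + 2 \<le> x}"

text \<open>Consecutive labels differ by \<open>K - 1\<close>, \<open>1\<close>,
  \<open>K - 2\<close> in turn. For \<open>K \<ge> 4\<close> these are pairwise distinct and the
  three labels pairwise compatible.\<close>

definition path_label :: "nat \<Rightarrow> nat" where
  "path_label i = (if i mod 3 = 0 then 1 else if i mod 3 = 1 then K else K - 1)"

lemma path_label_cases: "path_label i = 1 \<or> path_label i = K \<or> path_label i = K - 1"
  by (simp add: path_label_def)

lemma path_label_compatible: "compatible (path_label i) (path_label (Suc i))"
  unfolding path_label_def compatible_def mod_Suc using D1 D2 K by auto

lemma path_label_dist:
  "label_dist (path_label (Suc i)) (path_label i) \<noteq>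
   label_dist (path_label (Suc i)) (path_label (Suc (Suc i)))"
proof -
  have "i mod 3 = 0 \<or> i mod 3 = 1 \<or> i mod 3 = 2" by linarith
  then show ?thesis
    unfolding path_label_def label_dist_def mod_Suc using D1 D2 K by auto
qed

text \<open>Around 1, the top \<open>D1\<close> labels serve. Around \<open>K\<close> or
  \<open>K - 1\<close>, the block \<open>{1..D1}\<close> may lose one label, half of the centre; the
  other one of \<open>K\<close>, \<open>K - 1\<close> makes up for it.\<close>

lemma spread_primary:
  obtains N where "N \<subseteq> secondary_labels" "spread (path_label i) D1 N"
proof -
  \<comment> \<open>For \<open>D1 = 1\<close> the label \<open>K - 1 = D2 + 1\<close> is not a
    secondary label, so around \<open>K\<close> the single label 1 is taken.\<close>
  consider "path_label i = 1" | "path_label i = K" "D1 = 1" | "path_label i = K" "2 \<le> D1"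
    | "path_label i = K - 1"
    using path_label_cases[of i] D1 by linarith
  then show thesis
  proof cases
    case 1
    show thesis
    proof (rule that[of "{D2 + 2..K}"])
      show "spread (path_label i) D1 {D2 + 2..K}"
        using 1 K D2 by (auto simp: spread_def compatible_def intro!: label_dist_inj_ge)
    qed (auto simp: secondary_labels_def)
  next
    case 2
    show thesis
    proof (rule that[of "{1}"])
      show "spread (path_label i) D1 {1}"
        using 2 K D2 by (auto simp: spread_def compatible_def)
      show "{1} \<subseteq> secondary_labels"
        unfolding secondary_labels_def using D1 K by simp
    qed
  next
    case 3
    let ?N = "insert (K - 1) {1..D1} - {K div 2}"
    show thesis
    proof (rule that[of ?N])
      have "card (insert (K - 1) {1..D1}) = D1 + 1" using K D2 by simp
      then have "D1 \<le> card ?N" using diff_card_le_card_Diff[of "{K div 2}" "insert (K - 1) {1..D1}"]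
        by simp
      then show "spread (path_label i) D1 ?N"
        using 3 K D2 by (auto simp: spread_def compatible_def intro!: label_dist_inj_le)
      show "?N \<subseteq> secondary_labels"
        unfolding secondary_labels_def using 3 K by auto
    qed
  next
    case 4
    let ?N = "insert K {1..D1} - {(K - 1) div 2}"
    show thesis
    proof (rule that[of ?N])
      have "card (insert K {1..D1}) = D1 + 1" using K D2 by simp
      then have "D1 \<le> card ?N" using diff_card_le_card_Diff[of "{(K - 1) div 2}" "insert K {1..D1}"]
        by simp
      \<comment> \<open>The labels lie on both sides of \<open>K - 1\<close>, but \<open>K\<close>
        is at distance 1 and the labels up to \<open>D1\<close> at distance at least
        \<open>D2 \<ge> 2\<close>.\<close>
      moreover have "inj_on (label_dist (K - 1)) ?N"
        using K D2 by (auto simp: inj_on_def label_dist_def)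
      ultimately show "spread (path_label i) D1 ?N"
        using 4 K D1 D2 by (auto simp: spread_def compatible_def)
      show "?N \<subseteq> secondary_labels"
        unfolding secondary_labels_def using D1 K by auto
    qed
  qed
qed

text \<open>Each side of \<open>x\<close> loses at most one label, \<open>2 * x\<close> or
  \<open>x div 2\<close>. At least \<open>K - x - 1\<close> remain above, which is
  \<open>\<ge> D2\<close> when \<open>x \<le> D1\<close>; at least \<open>x - 2\<close> remain
  below, which is \<open>\<ge> D2\<close> when \<open>x \<ge> D2 + 2\<close>.\<close>

lemma spread_secondary:
  assumes "x \<in> secondary_labels"
  obtains N where "N \<subseteq> {1..K}" "spread x D2 N"
proof (cases "x \<le> D1")
  case True
  let ?N = "{x + 1..K} - {2 * x}"
  show thesis
  proof (rule that[of ?N])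
    have "D2 \<le> card ?N"
      using diff_card_le_card_Diff[of "{2 * x}" "{x + 1..K}"] True K by simp
    then show "spread x D2 ?N"
      by (auto simp: spread_def compatible_def intro!: label_dist_inj_ge)
  qed auto
next
  case False
  let ?N = "{1..x - 1} - {x div 2}"
  have x: "D2 + 2 \<le> x" "x \<le> K" using assms False by (auto simp: secondary_labels_def)
  show thesis
  proof (rule that[of ?N])
    have "D2 \<le> card ?N"
      using diff_card_le_card_Diff[of "{x div 2}" "{1..x - 1}"] x by simp
    then show "spread x D2 ?N"
      by (auto simp: spread_def compatible_def intro!: label_dist_inj_le)
  qed (use x in auto)
qed

text \<open>Labels go by position. A path in a tree has no chords, so compatibility matters only for
  consecutive positions, and distances only for the two positions on either side of a
  vertex.\<close>

lemma path_vertex_labeling: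
  assumes T: "tree V E" and P: "path_in V E P"
  obtains g where "vertex_labeling (set P) E g" "\<And>v. v \<in> set P \<Longrightarrow> \<exists>i. g v = path_label i"
proof -
  have dist: "distinct P" and G: "simple_graph V E"
    using P T by (auto simp: path_in_def tree_def)
  define g where "g = path_label \<circ> the_inv_into {..<length P} ((!) P)"
  have g: "g (P ! i) = path_label i" if "i < length P" for i
    using that dist by (simp add: g_def the_inv_into_f_f inj_on_nth)
  have adj: "j = Suc i \<or> i = Suc j"
    if "{P ! i, P ! j} \<in> E" "i < length P" "j < length P" for i j
    using tree_path_adjacent[OF T P, of i j] tree_path_adjacent[OF T P, of j i] that
      simple_graph_edge(3)[OF G that(1)] by (metis insert_commute nat_neq_iff)
  show thesis
  proof (rule that[of g])
    show "\<exists>i. g v = path_label i" if "v \<in> set P" for v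
      using that g by (metis in_set_conv_nth)
    show "vertex_labeling (set P) E g"
      unfolding vertex_labeling_def
    proof (intro conjI ballI impI)
      fix u v assume "u \<in> set P" "v \<in> set P" and e: "{u, v} \<in> E"
      then obtain i j where "i < length P" "u = P ! i" "j < length P" "v = P ! j"
        by (auto simp: in_set_conv_nth)
      then show "compatible (g u) (g v)"
        using adj[of i j] e g path_label_compatible compatible_sym by metis
    next
      fix v assume "v \<in> set P"
      then obtain j where j: "j < length P" "v = P ! j" by (auto simp: in_set_conv_nth)
      show "inj_on (\<lambda>u. label_dist (g v) (g u)) (set P \<inter> neighbours E v)"
      proof (rule inj_onI)
        fix u w assume "u \<in> set P \<inter> neighbours E v" "w \<in> set P \<inter> neighbours E v"
          and eq: "label_dist (g v) (g u) = label_dist (g v) (g w)"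
        then obtain i k where ik: "i < length P" "u = P ! i" "k < length P" "w = P ! k"
          and e: "{u, v} \<in> E" "{w, v} \<in> E"
          by (auto simp: in_set_conv_nth neighbours_def)
        then have "j = Suc i \<or> i = Suc j" "j = Suc k \<or> k = Suc j"
          using adj j by blast+
        moreover have False if "j = Suc i" "k = Suc j"
          using path_label_dist[of i] that eq g ik j by simp
        moreover have False if "j = Suc k" "i = Suc j"
          using path_label_dist[of k] that eq g ik j by simp
        ultimately show "u = w" using ik by auto
      qed
    qed
  qed
qed

end

section \<open>Structure of lobsters and their labeling\<close>

text \<open>A shortest walk from \<open>v\<close> to the central path has exactly two edges, and its
  middle vertex is secondary: on the central path it would make \<open>v\<close> secondary.\<close>

lemma lobster_vertex_cases:
  assumes L: "lobster V E P" and v: "v \<in> V" "v \<notin> primary P" "v \<notin> secondary V E P"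
  obtains s where "s \<in> secondary V E P" "{s, v} \<in> E"
proof -
  have T: "tree V E" and P: "path_in V E P" using L by (auto simp: lobster_def central_path_def)
  have G: "simple_graph V E" and conn: "connected_graph V E" using T by (auto simp: tree_def)
  obtain w where w: "w \<in> set P" "graph_dist V E v w \<le> 2"
    using L v(1) by (auto simp: lobster_def central_path_def)
  have "w \<in> V" using P w by (auto simp: path_in_def walk_def)
  \<comment> \<open>The list counts vertices, one more than the distance.\<close>
  then obtain p where p: "walk V E p" "hd p = v" "last p = w" "length p \<le> 3"
    using graph_dist_walk[OF conn v(1), of w] w(2) by (metis Suc_le_mono numeral_3_eq_3 numeral_2_eq_2)
  have not_adj: "{u, v} \<notin> E" if "u \<in> set P" for u
    using v that by (auto simp: secondary_def primary_def)
  consider a where "p = [a]" | a b where "p = [a, b]" | a b c where "p = [a, b, c]"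
    using p(1,4) by (cases p; cases "tl p"; cases "tl (tl p)") (auto simp: walk_def)
  then show thesis
  proof cases
    case 1
    then show thesis using p w v by (simp add: primary_def)
  next
    case 2
    then show thesis using p w not_adj[of w] by (simp add: walk_def insert_commute)
  next
    case 3
    then have e: "{v, b} \<in> E" "{b, w} \<in> E" "b \<in> V" using p by (auto simp: walk_def)
    have "b \<notin> set P" using not_adj[of b] e by (auto simp: insert_commute)
    then have "b \<in> secondary V E P"
      using e w by (auto simp: secondary_def primary_def insert_commute)
    then show thesis using that e by (simp add: insert_commute)
  qed
qed

text \<open>Some vertex has distance above 1 from \<open>P\<close>, so it is neither primary nor
  secondary; its secondary neighbour is also adjacent to \<open>P\<close>, which gives two
  neighbours.\<close>

lemma not_caterpillar_secondary_degree:
  assumes L: "lobster V E P" and "\<not> caterpillar V E"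
  obtains s where "s \<in> secondary V E P" "2 \<le> degree E s"
proof -
  have T: "tree V E" and P: "path_in V E P" using L by (auto simp: lobster_def central_path_def)
  have G: "simple_graph V E" using T by (simp add: tree_def)
  obtain v where v: "v \<in> V" and far: "\<And>w. w \<in> set P \<Longrightarrow> \<not> graph_dist V E v w \<le> 1"
    using assms(2) T P unfolding caterpillar_def central_path_def by blast
  have "v \<notin> set P"
    using far[of v] graph_dist_le[of V E "[v]" v v 0] v by (auto simp: walk_def)
  moreover have "v \<notin> secondary V E P"
  proof
    assume "v \<in> secondary V E P"
    then obtain u where "u \<in> set P" "{u, v} \<in> E" by (auto simp: secondary_def primary_def)
    then show False
      using far[of u] graph_dist_le[of V E "[v, u]" v u 1] simple_graph_edge[OF G, of u v]
      by (simp add: walk_def insert_commute)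
  qed
  ultimately obtain s where s: "s \<in> secondary V E P" "{s, v} \<in> E"
    using lobster_vertex_cases[OF L v] by (auto simp: primary_def)
  obtain u where u: "u \<in> set P" "{u, s} \<in> E" using s(1) by (auto simp: secondary_def primary_def)
  have "card {u, v} \<le> card (neighbours E s)"
    using u s by (intro card_mono finite_neighbours[OF G]) (auto simp: neighbours_def insert_commute)
  then have "2 \<le> degree E s"
    using u \<open>v \<notin> set P\<close> by (auto simp: degree_eq_card_neighbours[OF G] card_insert_if split: if_splits)
  with s that show thesis by blast
qed

lemma lobster_vertex_labeling:
  assumes L: "lobster V E P" and "\<not> caterpillar V E"
    and K: "K = max_degree E (primary P) + max_degree E (secondary V E P) + 1"
  obtains g where "vertex_labeling V E g" "\<And>v. v \<in> V \<Longrightarrow> g v \<in> {1..K}"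
proof -
  let ?S = "secondary V E P"
  \<comment> \<open>The tertiary vertices, taken as all that remain.\<close>
  let ?T = "V - set P - ?S"
  define D1 where "D1 = max_degree E (primary P)"
  define D2 where "D2 = max_degree E ?S"
  have T: "tree V E" and P: "path_in V E P" using L by (auto simp: lobster_def central_path_def)
  have G: "simple_graph V E" using T by (simp add: tree_def)
  have finV: "finite V" using G by (simp add: simple_graph_def)
  have PV: "set P \<subseteq> V" using P by (simp add: path_in_def walk_def)
  have S: "s \<in> ?S \<longleftrightarrow> s \<in> V \<and> s \<notin> set P \<and> (\<exists>u\<in>set P. {u, s} \<in> E)" for s
    by (simp add: secondary_def primary_def)
  have deg1: "degree E v \<le> D1" if "v \<in> set P" for v
    unfolding D1_def using that by (auto simp: primary_def intro: degree_le_max_degree)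
  have deg2: "degree E v \<le> D2" if "v \<in> ?S" for v
    unfolding D2_def using that finV by (auto simp: secondary_def intro: degree_le_max_degree)
  obtain s where s: "s \<in> ?S" "2 \<le> degree E s"
    using not_caterpillar_secondary_degree[OF L assms(2)] .
  obtain u where u: "u \<in> set P" "{u, s} \<in> E" using s(1) S by blast
  have "card {s} \<le> card (neighbours E u)"
    using u by (intro card_mono finite_neighbours[OF G]) (auto simp: neighbours_def insert_commute)
  then have "1 \<le> D1" using deg1[OF u(1)] by (simp add: degree_eq_card_neighbours[OF G])
  then interpret lobster_labels D1 D2 K
    using deg2[OF s(1)] s(2) K by unfold_locales (auto simp: D1_def D2_def)

  have detour: "p = p' \<and> length Q = 1"
    if "path_in V E Q" "set P \<inter> set Q = {}" "p \<in> set P" "p' \<in> set P"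
      "{p, hd Q} \<in> E" "{p', last Q} \<in> E" for p p' Q
    using tree_no_detour[OF T P that(1,2,3,4,5,6)] .
  \<comment> \<open>Each use contradicts this with a longer list: secondary vertices are
    independent, a vertex of \<open>?T\<close> has only one secondary neighbour, and
    \<open>?T\<close> is independent.\<close>
  have S_path: "length Q = 1" if "path_in V E Q" "set P \<inter> set Q = {}" "hd Q \<in> ?S" "last Q \<in> ?S" for Q
    using detour[OF that(1,2)] that(3,4) S by blast
  have edge: "a \<in> V \<and> b \<in> V \<and> a \<noteq> b" if "{a, b} \<in> E" for a b
    using simple_graph_edge[OF G that] by blast

  obtain g0 where g0: "vertex_labeling (set P) E g0" "\<And>v. v \<in> set P \<Longrightarrow> \<exists>i. g0 v = path_label i"
    using path_vertex_labeling[OF T P] by blast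
  have "\<exists>N. N \<subseteq> secondary_labels \<and> spread (g0 v) D1 N" if "v \<in> set P" for v
    using g0(2)[OF that] spread_primary by metis
  then obtain N where N: "\<And>v. v \<in> set P \<Longrightarrow> N v \<subseteq> secondary_labels \<and> spread (g0 v) D1 (N v)"
    by metis
  obtain g1 where g1: "vertex_labeling (set P \<union> ?S) E g1" "\<And>v. v \<in> set P \<Longrightarrow> g1 v = g0 v"
    "\<And>c. c \<in> ?S \<Longrightarrow> \<exists>w \<in> set P \<inter> neighbours E c. g1 c \<in> N w"
  \<comment> \<open>Second round: the secondary vertices, each with its only neighbour on
    \<open>P\<close> as parent.\<close>
  proof (rule extend_vertex_labeling[OF G g0(1), of ?S N])
    show "set P \<inter> ?S = {}" using S by blast
    show "\<exists>w. set P \<inter> neighbours E c = {w}" if "c \<in> ?S" for c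
    proof -
      obtain w where w: "w \<in> set P" "{w, c} \<in> E" using \<open>c \<in> ?S\<close> S by blast
      have "w' = w" if "w' \<in> set P" "{w', c} \<in> E" for w'
        using detour[of "[c]" w' w] w that \<open>c \<in> ?S\<close> S by (auto simp: path_in_singleton)
      then show ?thesis using w by (auto simp: neighbours_def)
    qed
    show "{c, c'} \<notin> E" if "c \<in> ?S" "c' \<in> ?S" for c c'
    proof
      assume "{c, c'} \<in> E"
      then have "length [c, c'] = 1"
        using that S edge[of c c'] by (intro S_path) (auto simp: path_in_Cons path_in_singleton)
      then show False by simp
    qed
    show "finite (N w) \<and> inj_on (label_dist (g0 w)) (N w) \<and> (\<forall>y\<in>N w. compatible (g0 w) y) \<and>
        degree E w \<le> card (N w)" if "w \<in> set P" for w
      using N[OF that] deg1[OF that] by (auto simp: spread_def)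
  qed blast
  have g1_S: "g1 c \<in> secondary_labels" if "c \<in> ?S" for c
    using g1(3)[OF that] N by blast

  have "\<exists>N. N \<subseteq> {1..K} \<and> spread (g1 v) D2 N" if "v \<in> ?S" for v
    using g1_S[OF that] spread_secondary by metis
  then obtain M where M: "\<And>v. v \<in> ?S \<Longrightarrow> M v \<subseteq> {1..K} \<and> spread (g1 v) D2 (M v)"
    by metis
  have T_nbr: "\<exists>s\<in>?S. {s, t} \<in> E" if "t \<in> ?T" for t
    using lobster_vertex_cases[OF L, of t] that by (auto simp: primary_def)
  have T_P: "{p, t} \<notin> E" if "t \<in> ?T" "p \<in> set P" for t p
    using that S by blast
  obtain g2 where g2: "vertex_labeling (set P \<union> ?S \<union> ?T) E g2"
    "\<And>v. v \<in> set P \<union> ?S \<Longrightarrow> g2 v = g1 v"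
    "\<And>c. c \<in> ?T \<Longrightarrow> \<exists>w \<in> (set P \<union> ?S) \<inter> neighbours E c. g2 c \<in> M w"
  \<comment> \<open>Third round: the vertices of \<open>?T\<close>, each with its only secondary
    neighbour as parent.\<close>
  proof (rule extend_vertex_labeling[OF G g1(1), of ?T M])
    show "(set P \<union> ?S) \<inter> ?T = {}" by blast
    show "\<exists>w. (set P \<union> ?S) \<inter> neighbours E t = {w}" if t: "t \<in> ?T" for t
    proof -
      obtain s where s: "s \<in> ?S" "{s, t} \<in> E" using T_nbr[OF t] by blast
      have "s' = s" if s': "s' \<in> ?S" "{s', t} \<in> E" for s'
      proof (rule ccontr)
        assume "s' \<noteq> s"
        then have "length [s, t, s'] = 1"
          using s s' t S edge[of s t] edge[of s' t]
          by (intro S_path) (auto simp: path_in_Cons path_in_singleton insert_commute)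
        then show False by simp
      qed
      then show ?thesis using s T_P[OF t] unfolding neighbours_def by blast
    qed
    show "{t, t'} \<notin> E" if t: "t \<in> ?T" "t' \<in> ?T" for t t'
    proof
      assume e: "{t, t'} \<in> E"
      obtain s where s: "s \<in> ?S" "{s, t} \<in> E" using T_nbr[OF t(1)] by blast
      obtain s' where s': "s' \<in> ?S" "{s', t'} \<in> E" using T_nbr[OF t(2)] by blast
      have "s \<noteq> s'"
        using tree_no_triangle[OF T s(2) e] s'(2) by (auto simp: insert_commute)
      then have "length [s, t, t', s'] = 1"
        using s s' t S e edge[of s t] edge[of s' t'] edge[of t t']
        by (intro S_path) (auto simp: path_in_Cons path_in_singleton insert_commute)
      then show False by simp
    qed
    show "finite (M w) \<and> inj_on (label_dist (g1 w)) (M w) \<and> (\<forall>y\<in>M w. compatible (g1 w) y) \<and>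
        degree E w \<le> card (M w)" if w: "w \<in> set P \<union> ?S" "?T \<inter> neighbours E w \<noteq> {}" for w
    proof -
      \<comment> \<open>A vertex with a neighbour in \<open>?T\<close> is not on \<open>P\<close>,
        so the bound \<open>D2\<close> and the choice of \<open>M\<close> apply to it.\<close>
      have "w \<in> ?S" using w T_P by (auto simp: neighbours_def insert_commute)
      then show ?thesis using M[of w] deg2[of w] by (auto simp: spread_def)
    qed
  qed blast
  have V: "V = set P \<union> ?S \<union> ?T" using PV S by blast
  have "g2 v \<in> {1..K}" if v: "v \<in> V" for v
  proof -
    consider "v \<in> set P" | "v \<in> ?S" | "v \<in> ?T" using V v by blast
    then show ?thesis
    proof cases
      case 1
      then obtain i where "g2 v = path_label i" using g0(2) g1(2) g2(2) by force
      then show ?thesis using path_label_cases[of i] D1 D2 lobster_labels.K[OF lobster_labels_axioms] by auto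
    next
      case 2
      then show ?thesis using g1_S[OF 2] g2(2) by (auto simp: secondary_labels_def)
    next
      case 3
      obtain w where w: "w \<in> set P \<union> ?S" "w \<in> neighbours E v" "g2 v \<in> M w"
        using g2(3)[OF 3] by blast
      then have "w \<in> ?S" using T_P[OF 3] by (auto simp: neighbours_def)
      then show ?thesis using M w(3) by blast
    qed
  qed
  with g2(1) V that show thesis by simp
qed

section \<open>The two bounds\<close>

theorem theorem6p10:
  fixes V :: "'a set" and E :: "'a set set" and P :: "'a list"
  assumes "lobster V E P"
    and "\<not> path_graph V E"
    and "\<not> caterpillar V E"
  shows "max_degree E V + 1 \<le> chi_td V E \<and>
    chi_td V E \<le> max_degree E (primary P) + max_degree E (secondary V E P) + 1"
proof -
  let ?K = "max_degree E (primary P) + max_degree E (secondary V E P) + 1"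
  have G: "simple_graph V E" and "V \<noteq> {}"
    using assms(1) by (auto simp: lobster_def tree_def connected_graph_def)
  obtain g where "vertex_labeling V E g" "\<And>v. v \<in> V \<Longrightarrow> g v \<in> {1..?K}"
    using lobster_vertex_labeling[OF assms(1,3) refl] by blast
  then obtain k f where kf: "k_total_difference_labeling V E k f" "k \<le> ?K"
    using total_difference_labeling_of_vertex_labeling[OF G \<open>V \<noteq> {}\<close>] by metis
  have "chi_td V E \<le> k"
    unfolding chi_td_def using kf(1) by (blast intro: Least_le)
  moreover have "max_degree E V + 1 \<le> chi_td V E"
  proof -
    \<comment> \<open>The labeling found for the upper bound ensures that the minimum is attained;
      an optimal labeling is then examined at a vertex of maximum degree.\<close>
    obtain f where "k_total_difference_labeling V E (chi_td V E) f"
      unfolding chi_td_def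
      using LeastI[of "\<lambda>k. \<exists>f. k_total_difference_labeling V E k f", OF exI, OF kf(1)] by blast
    then have f: "k_total_labeling V E (chi_td V E) f"
      by (simp add: k_total_difference_labeling_def)
    have "max_degree E V \<in> degree E ` V"
      unfolding max_degree_def using G \<open>V \<noteq> {}\<close> by (intro Max_in) (auto simp: simple_graph_def)
    then show ?thesis using degree_less_label_bound[OF G _ f] by auto
  qed
  ultimately show ?thesis using kf(2) by simp
qed

end
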